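(* Let $X,P$ be metric spaces, $Y$ a normed vector space, $H:X\times P\rightrightarrows Y$ a set-valued map and $(\overline{x},\overline{p},0)\in\operatorname{Gr}H$ (that is, $0\in H(\overline{x},\overline{p})$). Define the implicit multifunction $S:P\rightrightarrows X$ by $S(p):=\{x\in X\mid 0\in H(x,p)\}$, so that $S^{-1}(x)=\{p\in P\mid 0\in H(x,p)\}$. (i) If $H$ is open with linear rate $c>0$ with respect to $x$ uniformly in $p$ around $(\overline{x},\overline{p},0)$, then there exist $\alpha,\beta,\gamma>0$ such that, for every $(x,p)\in B(\overline{x},\alpha)\times B(\overline{p},\beta)$, $$d(x,S(p))\leq c^{-1}d(0,H(x,p)\cap B(0,\gamma)).$$ If, in addition, $H$ is Lipschitz-like with respect to $p$ uniformly in $x$ around $(\overline{x},\overline{p},0)$, then $S$ is Lipschitz-like around $(\overline{p},\overline{x})$ and $$\operatorname{lip}S(\overline{p},\overline{x})\leq c^{-1}\,\widehat{\operatorname{lip}}_{p}H((\overline{x},\overline{p}),0).$$ (ii) If $H$ is open with linear rate $c>0$ with respect to $p$ uniformly in $x$ around $(\overline{x},\overline{p},0)$, then there exist $\alpha,\beta,\gamma>0$ such that, for every $(x,p)\in B(\overline{x},\alpha)\times B(\overline{p},\beta)$, $$d(p,S^{-1}(x))\leq c^{-1}d(0,H(x,p)\cap B(0,\gamma)).$$ If, moreover, $H$ is Lipschitz-like with respect to $x$ uniformly in $p$ around $(\overline{x},\overline{p},0)$, then $S$ is metrically regular around $(\overline{p},\overline{x})$ and $$\operatorname{reg}S(\overline{p},\overline{x})\leq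 c^{-1}\,\widehat{\operatorname{lip}}_{x}H((\overline{x},\overline{p}),0).$$
   Context: A set-valued map (multifunction) $F:X\rightrightarrows Y$ assigns to each $x$ a (possibly empty) subset $F(x)\subset Y$; $\operatorname{Gr}F=\{(x,y)\mid y\in F(x)\}$; $F(A):=\bigcup_{x\in A}F(x)$; $F^{-1}(y):=\{x\mid y\in F(x)\}$. $B(x,r)$ is the open ball with center $x$ and radius $r$; $\mathbb{D}_Y$ is the closed unit ball of $Y$. $d(x,A):=\inf\{d(x,a)\mid a\in A\}$, with the convention $d(x,\emptyset)=\infty$. For $H:X\times P\rightrightarrows Y$ put $H_p(\cdot):=H(\cdot,p)$ and $H_x(\cdot):=H(x,\cdot)$. $H$ is open at linear rate $c>0$ with respect to $x$ uniformly in $p$ around $((\overline{x},\overline{p}),\overline{y})\in\operatorname{Gr}H$ if there exist $\varepsilon>0$ and neighborhoods $U$ of $\overline{x}$, $V$ of $\overline{p}$, $W$ of $\overline{y}$ such that, for every $\rho\in(0,\varepsilon)$, every $p\in V$ and every $(x,y)\in\operatorname{Gr}H_p\cap[U\times W]$, one has $B(y,\rho c)\subset H_p(B(x,\rho))$. $H$ is Lipschitz-like with respect to $x$ uniformly in $p$ around $((\overline{x},\overline{p}),\overline{y})$ with constant $L>0$ if there exist neighborhoods $U$ of $\overline{x}$, $V$ of $\overline{p}$, $W$ of $\overline{y}$ such that, for every $x,u\in U$ and every $p\in V$, $H_p(x)\cap W\subset H_p(u)+L\,d(x,u)\mathbb{D}_Y$. It is Lipschitz-like in this sense (without mention of a constant)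 if this holds for some $L>0$; the infimum of $L>0$ over all combinations $(L,U,V,W)$ for which this holds is denoted $\widehat{\operatorname{lip}}_xH((\overline{x},\overline{p}),\overline{y})$. The notions with respect to $p$ uniformly in $x$, and $\widehat{\operatorname{lip}}_pH((\overline{x},\overline{p}),\overline{y})$, are defined by exchanging the roles of $x$ and $p$ (using $H_x$). For a multifunction $S:P\rightrightarrows X$ between metric spaces and $(\overline{p},\overline{x})\in\operatorname{Gr}S$: $S$ is Lipschitz-like around $(\overline{p},\overline{x})$ with constant $L>0$ if there are neighborhoods $V$ of $\overline{p}$ and $U$ of $\overline{x}$ such that for all $p_1,p_2\in V$ and every $x\in S(p_1)\cap U$ one has $d(x,S(p_2))\le L\,d(p_1,p_2)$; the infimum of such $L$ (over all $(L,U,V)$) is $\operatorname{lip}S(\overline{p},\overline{x})$. (When $X$ is a normed space this is, up to the infimum, the usual inclusion $S(p_1)\cap U\subset S(p_2)+L\,d(p_1,p_2)\mathbb{D}_X$.) $S$ is metrically regular around $(\overline{p},\overline{x})$ with constant $L>0$ if there are neighborhoods $V$ of $\overline{p}$ and $U$ of $\overline{x}$ such that $d(p,S^{-1}(x))\leq L\,d(x,S(p))$ for every $(p,x)\in V\times U$; the infimum of such $L$ (over all $(L,U,V)$) is $\operatorname{reg}S(\overline{p},\overline{x})$. "Lipschitz-like" or "metrically regular" without a constant means for some constant $L>0$. *)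

theory Defs
  imports "HOL-Analysis.Analysis"
begin

text \<open>A multifunction from \<open>'a\<close> to \<open>'b\<close> is a function \<open>'a \<Rightarrow> 'b set\<close>; a multifunction \<open>H\<close> on a
  product is curried, so that \<open>H\<^sub>p\<close> is \<open>\<lambda>x. H x p\<close> and \<open>H\<^sub>x\<close> is \<open>H x\<close>.
  A neighborhood of \<open>a\<close> is any set \<open>U\<close> with \<open>a \<in> interior U\<close>.\<close>

text \<open>The library's \<^const>\<open>infdist\<close> is 0 for the empty set, while the convention
  needed here is \<open>d x {} = \<infinity>\<close>, hence the extended-real infimum.\<close>

definition dist_set :: "'a::metric_space \<Rightarrow> 'a set \<Rightarrow> ereal" where
  "dist_set x A = (INF a\<in>A. ereal (dist x a))"

definition mf_inverse :: "('a \<Rightarrow> 'b set) \<Rightarrow> 'b \<Rightarrow> 'a set" where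
  "mf_inverse F y = {x. y \<in> F x}"

definition implicit_mf :: "('x \<Rightarrow> 'p \<Rightarrow> 'y::zero set) \<Rightarrow> 'p \<Rightarrow> 'x set" where
  "implicit_mf H p = {x. 0 \<in> H x p}"

definition open_at_rate_x ::
  "real \<Rightarrow> ('x::metric_space \<Rightarrow> 'p::metric_space \<Rightarrow> 'y::real_normed_vector set)
    \<Rightarrow> 'x \<Rightarrow> 'p \<Rightarrow> 'y \<Rightarrow> bool" where
  "open_at_rate_x c H xb pb yb \<longleftrightarrow>
    (\<exists>\<epsilon>>0. \<exists>U V W. xb \<in> interior U \<and> pb \<in> interior V \<and> yb \<in> interior W \<and>
      (\<forall>\<rho>. 0 < \<rho> \<and> \<rho> < \<epsilon> \<longrightarrow>
        (\<forall>p\<in>V. \<forall>x\<in>U. \<forall>y\<in>H x p \<inter> W.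
          ball y (\<rho> * c) \<subseteq> (\<Union>u\<in>ball x \<rho>. H u p))))"

definition open_at_rate_p ::
  "real \<Rightarrow> ('x::metric_space \<Rightarrow> 'p::metric_space \<Rightarrow> 'y::real_normed_vector set)
    \<Rightarrow> 'x \<Rightarrow> 'p \<Rightarrow> 'y \<Rightarrow> bool" where
  "open_at_rate_p c H xb pb yb \<longleftrightarrow> open_at_rate_x c (\<lambda>p x. H x p) pb xb yb"

definition lipschitz_like_const_x ::
  "real \<Rightarrow> ('x::metric_space \<Rightarrow> 'p::metric_space \<Rightarrow> 'y::real_normed_vector set)
    \<Rightarrow> 'x \<Rightarrow> 'p \<Rightarrow> 'y \<Rightarrow> bool" where
  "lipschitz_like_const_x L H xb pb yb \<longleftrightarrow>
    (\<exists>U V W. xb \<in> interior U \<and> pb \<in> interior V \<and> yb \<in> interior W \<and>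
      (\<forall>x\<in>U. \<forall>u\<in>U. \<forall>p\<in>V.
        H x p \<inter> W \<subseteq> {z + (L * dist x u) *\<^sub>R v | z v. z \<in> H u p \<and> v \<in> cball 0 1}))"

definition lipschitz_like_x ::
  "('x::metric_space \<Rightarrow> 'p::metric_space \<Rightarrow> 'y::real_normed_vector set)
    \<Rightarrow> 'x \<Rightarrow> 'p \<Rightarrow> 'y \<Rightarrow> bool" where
  "lipschitz_like_x H xb pb yb \<longleftrightarrow> (\<exists>L>0. lipschitz_like_const_x L H xb pb yb)"

text \<open>The moduli are extended reals, with value \<open>\<infinity>\<close> if no constant is admissible.\<close>

definition lip_hat_x ::
  "('x::metric_space \<Rightarrow> 'p::metric_space \<Rightarrow> 'y::real_normed_vector set)
    \<Rightarrow> 'x \<Rightarrow> 'p \<Rightarrow> 'y \<Rightarrow> ereal" where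
  "lip_hat_x H xb pb yb = (INF L\<in>{L. 0 < L \<and> lipschitz_like_const_x L H xb pb yb}. ereal L)"

definition lipschitz_like_p ::
  "('x::metric_space \<Rightarrow> 'p::metric_space \<Rightarrow> 'y::real_normed_vector set)
    \<Rightarrow> 'x \<Rightarrow> 'p \<Rightarrow> 'y \<Rightarrow> bool" where
  "lipschitz_like_p H xb pb yb \<longleftrightarrow> lipschitz_like_x (\<lambda>p x. H x p) pb xb yb"

definition lip_hat_p ::
  "('x::metric_space \<Rightarrow> 'p::metric_space \<Rightarrow> 'y::real_normed_vector set)
    \<Rightarrow> 'x \<Rightarrow> 'p \<Rightarrow> 'y \<Rightarrow> ereal" where
  "lip_hat_p H xb pb yb = lip_hat_x (\<lambda>p x. H x p) pb xb yb"

definition lipschitz_like_const ::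
  "real \<Rightarrow> ('p::metric_space \<Rightarrow> 'x::metric_space set) \<Rightarrow> 'p \<Rightarrow> 'x \<Rightarrow> bool" where
  "lipschitz_like_const L S pb xb \<longleftrightarrow>
    (\<exists>V U. pb \<in> interior V \<and> xb \<in> interior U \<and>
      (\<forall>p1\<in>V. \<forall>p2\<in>V. \<forall>x\<in>S p1 \<inter> U.
        dist_set x (S p2) \<le> ereal (L * dist p1 p2)))"

definition lipschitz_like ::
  "('p::metric_space \<Rightarrow> 'x::metric_space set) \<Rightarrow> 'p \<Rightarrow> 'x \<Rightarrow> bool" where
  "lipschitz_like S pb xb \<longleftrightarrow> (\<exists>L>0. lipschitz_like_const L S pb xb)"

definition lip_modulus ::
  "('p::metric_space \<Rightarrow> 'x::metric_space set) \<Rightarrow> 'p \<Rightarrow> 'x \<Rightarrow> ereal" where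
  "lip_modulus S pb xb = (INF L\<in>{L. 0 < L \<and> lipschitz_like_const L S pb xb}. ereal L)"

definition metrically_regular_const ::
  "real \<Rightarrow> ('p::metric_space \<Rightarrow> 'x::metric_space set) \<Rightarrow> 'p \<Rightarrow> 'x \<Rightarrow> bool" where
  "metrically_regular_const L S pb xb \<longleftrightarrow>
    (\<exists>V U. pb \<in> interior V \<and> xb \<in> interior U \<and>
      (\<forall>p\<in>V. \<forall>x\<in>U. dist_set p (mf_inverse S x) \<le> ereal L * dist_set x (S p)))"

definition metrically_regular ::
  "('p::metric_space \<Rightarrow> 'x::metric_space set) \<Rightarrow> 'p \<Rightarrow> 'x \<Rightarrow> bool" where
  "metrically_regular S pb xb \<longleftrightarrow> (\<exists>L>0. metrically_regular_const L S pb xb)"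

definition reg_modulus ::
  "('p::metric_space \<Rightarrow> 'x::metric_space set) \<Rightarrow> 'p \<Rightarrow> 'x \<Rightarrow> ereal" where
  "reg_modulus S pb xb = (INF L\<in>{L. 0 < L \<and> metrically_regular_const L S pb xb}. ereal L)"

end

theory Submission
  imports Defs
begin

text \<open>
  If \<open>y \<in> H x p\<close> is close to \<open>0\<close>, openness at rate \<open>c\<close> with a radius \<open>\<rho>\<close> just above
  \<open>norm y / c\<close> puts \<open>0\<close> into \<open>H u p\<close> for some \<open>u\<close> with \<open>dist x u < \<rho>\<close>, that is, a solution \<open>u \<in> S p\<close>
  at distance less than \<open>\<rho>\<close> from \<open>x\<close>. Letting \<open>\<rho>\<close> decrease to \<open>norm y / c\<close> gives the error bound
  \<open>d x (S p) \<le> norm y / c\<close> (lemma \<open>dist_solution_set_le_residual\<close>), and the infimum over \<open>y\<close> gives the first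
  estimate. If \<open>H\<close> is also Lipschitz-like in \<open>p\<close> with constant \<open>L\<close> and \<open>0 \<in> H x p1\<close>, then \<open>H x p2\<close>
  contains a residual of norm at most \<open>L * dist p1 p2\<close>, and the error bound makes \<open>S\<close> Lipschitz-like
  with constant \<open>L / c\<close> (lemma \<open>implicit_mf_lipschitz_like\<close>).

  The second half is the first half for \<open>H\<close> with its two arguments exchanged, whose implicit multifunction
  is \<open>S\<inverse>\<close>. It remains to turn the Lipschitz property of \<open>S\<inverse>\<close> into metric regularity of \<open>S\<close> with the same
  constant. This is the classical equivalence, of which \<open>lipschitz_like_imp_inverse_metrically_regular\<close> proves
  the implication used here; the point that needs an argument is that metric regularity also involves
  points of \<open>S p\<close> far away from the reference point.
\<close>

lemma le_mult_INF_ereal: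
  fixes a :: ereal and k :: real and f :: "'i \<Rightarrow> real"
  assumes "k > 0" and "\<And>i. i \<in> I \<Longrightarrow> a \<le> ereal (k * f i)"
  shows "a \<le> ereal k * (INF i\<in>I. ereal (f i))"
proof -
  have "a / ereal k \<le> (INF i\<in>I. ereal (f i))"
    using assms by (intro INF_greatest) (simp add: ereal_divide_le_pos)
  then show ?thesis
    using assms(1) by (simp add: ereal_divide_le_pos)
qed

lemma dist_set_le: "a \<in> A \<Longrightarrow> dist_set x A \<le> ereal (dist x a)"
  unfolding dist_set_def by (rule INF_lower)

lemma dist_set_triangle: "dist_set x A \<le> ereal (dist x y) + dist_set y A"
proof -
  have "dist_set x A - ereal (dist x y) \<le> dist_set y A"
    unfolding dist_set_def[of y]
  proof (rule INF_greatest)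
    fix a assume "a \<in> A"
    then have "dist_set x A \<le> ereal (dist x a)" by (rule dist_set_le)
    also have "\<dots> \<le> ereal (dist y a) + ereal (dist x y)"
      by (simp add: dist_triangle add.commute)
    finally show "dist_set x A - ereal (dist x y) \<le> ereal (dist y a)"
      by (simp add: ereal_minus_le_iff add.commute)
  qed
  then show ?thesis
    by (simp add: ereal_minus_le_iff add.commute)
qed

text \<open>The radius \<open>\<gamma>\<close> is at most \<open>\<epsilon> * c\<close>, so that \<open>norm y / c < \<epsilon>\<close> leaves room for admissible radii
  \<open>\<rho>\<close> above \<open>norm y / c\<close>. They are needed because openness concerns open balls, and
  \<open>0\<close> lies in \<open>ball y (\<rho> * c)\<close> only if \<open>\<rho>\<close> exceeds \<open>norm y / c\<close> strictly.\<close>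

lemma dist_solution_set_le_residual:
  fixes H :: "'x::metric_space \<Rightarrow> 'p::metric_space \<Rightarrow> 'y::real_normed_vector set"
  assumes "open_at_rate_x c H xb pb 0" and "c > 0"
  obtains \<alpha> \<beta> \<gamma> where "\<alpha> > 0" "\<beta> > 0" "\<gamma> > 0"
    and "\<And>x p y. x \<in> ball xb \<alpha> \<Longrightarrow> p \<in> ball pb \<beta> \<Longrightarrow> y \<in> H x p \<Longrightarrow> y \<in> ball 0 \<gamma> \<Longrightarrow>
           dist_set x (implicit_mf H p) \<le> ereal (inverse c * norm y)"
proof -
  obtain \<epsilon> U V W where "\<epsilon> > 0"
    and nbhds: "xb \<in> interior U" "pb \<in> interior V" "0 \<in> interior W"
    and opn: "\<forall>\<rho>. 0 < \<rho> \<and> \<rho> < \<epsilon> \<longrightarrow> (\<forall>p\<in>V. \<forall>x\<in>U. \<forall>y\<in>H x p \<inter> W.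
      ball y (\<rho> * c) \<subseteq> (\<Union>u\<in>ball x \<rho>. H u p))"
    using assms(1) unfolding open_at_rate_x_def by (elim exE conjE)
  obtain \<alpha> \<beta> r where pos: "\<alpha> > 0" "\<beta> > 0" "r > 0"
    and sub: "ball xb \<alpha> \<subseteq> U" "ball pb \<beta> \<subseteq> V" "ball 0 r \<subseteq> W"
    using nbhds unfolding mem_interior by (elim exE conjE)
  show ?thesis
  proof (rule that[of \<alpha> \<beta> "min r (\<epsilon> * c)"])
    fix x p y
    assume x: "x \<in> ball xb \<alpha>" and p: "p \<in> ball pb \<beta>" and y: "y \<in> H x p" "y \<in> ball 0 (min r (\<epsilon> * c))"
    have "norm y / c < \<epsilon>"
      using y(2) \<open>c > 0\<close> by (simp add: pos_divide_less_eq)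
    have "dist_set x (implicit_mf H p) \<le> z" if "ereal (norm y / c) < z" for z
    proof -
      have "ereal (norm y / c) < min z (ereal \<epsilon>)"
        using that \<open>norm y / c < \<epsilon>\<close> by simp
      then obtain \<rho> where \<rho>: "norm y / c < \<rho>" "ereal \<rho> < z" "\<rho> < \<epsilon>"
        using ereal_dense2 by fastforce
      have "0 \<le> norm y / c" using \<open>c > 0\<close> by simp
      then have "0 < \<rho>" using \<rho>(1) by linarith
      then have "ball y (\<rho> * c) \<subseteq> (\<Union>u\<in>ball x \<rho>. H u p)"
        using opn[rule_format, of \<rho> p x y] \<rho>(3) x p y sub by (simp add: subset_iff)
      moreover have "0 \<in> ball y (\<rho> * c)"
        using \<rho>(1) \<open>c > 0\<close> by (simp add: pos_divide_less_eq)
      ultimately have "0 \<in> (\<Union>u\<in>ball x \<rho>. H u p)" by (rule subsetD)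
      then obtain u where u: "dist x u < \<rho>" "0 \<in> H u p" by auto
      have "dist_set x (implicit_mf H p) \<le> ereal (dist x u)"
        using u(2) by (intro dist_set_le) (simp add: implicit_mf_def)
      also have "\<dots> \<le> ereal \<rho>" using u(1) by simp
      finally show ?thesis using \<rho>(2) by simp
    qed
    then have "dist_set x (implicit_mf H p) \<le> ereal (norm y / c)"
      by (rule dense_ge)
    then show "dist_set x (implicit_mf H p) \<le> ereal (inverse c * norm y)"
      by (simp add: divide_inverse mult.commute)
  qed (use pos \<open>\<epsilon> > 0\<close> \<open>c > 0\<close> in auto)
qed

lemma implicit_mf_error_bound:
  fixes H :: "'x::metric_space \<Rightarrow> 'p::metric_space \<Rightarrow> 'y::real_normed_vector set"
  assumes "open_at_rate_x c H xb pb 0" and "c > 0"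
  shows "\<exists>\<alpha>>0. \<exists>\<beta>>0. \<exists>\<gamma>>0. \<forall>x\<in>ball xb \<alpha>. \<forall>p\<in>ball pb \<beta>.
    dist_set x (implicit_mf H p) \<le> ereal (inverse c) * dist_set 0 (H x p \<inter> ball 0 \<gamma>)"
proof -
  obtain \<alpha> \<beta> \<gamma> where pos: "\<alpha> > 0" "\<beta> > 0" "\<gamma> > 0"
    and res: "\<And>x p y. x \<in> ball xb \<alpha> \<Longrightarrow> p \<in> ball pb \<beta> \<Longrightarrow> y \<in> H x p \<Longrightarrow> y \<in> ball 0 \<gamma> \<Longrightarrow>
           dist_set x (implicit_mf H p) \<le> ereal (inverse c * norm y)"
    using dist_solution_set_le_residual[OF assms] by blast
  have "dist_set x (implicit_mf H p) \<le> ereal (inverse c) * dist_set 0 (H x p \<inter> ball 0 \<gamma>)"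
    if "x \<in> ball xb \<alpha>" "p \<in> ball pb \<beta>" for x p
    unfolding dist_set_def[of 0]
  proof (rule le_mult_INF_ereal)
    fix y assume "y \<in> H x p \<inter> ball 0 \<gamma>"
    then show "dist_set x (implicit_mf H p) \<le> ereal (inverse c * dist 0 y)"
      using res[OF that] by simp
  qed (use \<open>c > 0\<close> in simp)
  with pos show ?thesis by blast
qed

text \<open>A solution \<open>x\<close> for the parameter \<open>p1\<close> almost solves the problem for \<open>p2\<close>: its residual there is
  at most \<open>L * dist p1 p2\<close>. The parameters are kept so close together that this residual is below
  the radius \<open>\<gamma>\<close> of the error bound.\<close>

lemma implicit_mf_lipschitz_like:
  fixes H :: "'x::metric_space \<Rightarrow> 'p::metric_space \<Rightarrow> 'y::real_normed_vector set"
  assumes "open_at_rate_x c H xb pb 0" and "c > 0"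
    and "lipschitz_like_const_x L (\<lambda>p x. H x p) pb xb 0" and "L > 0"
  shows "lipschitz_like_const (inverse c * L) (implicit_mf H) pb xb"
proof -
  obtain \<alpha> \<beta> \<gamma> where pos: "\<alpha> > 0" "\<beta> > 0" "\<gamma> > 0"
    and res: "\<And>x p y. x \<in> ball xb \<alpha> \<Longrightarrow> p \<in> ball pb \<beta> \<Longrightarrow> y \<in> H x p \<Longrightarrow> y \<in> ball 0 \<gamma> \<Longrightarrow>
           dist_set x (implicit_mf H p) \<le> ereal (inverse c * norm y)"
    using dist_solution_set_le_residual[OF assms(1,2)] by blast
  obtain V U W where nbhds: "pb \<in> interior V" "xb \<in> interior U" "0 \<in> interior W"
    and lip: "\<And>p q x. p \<in> V \<Longrightarrow> q \<in> V \<Longrightarrow> x \<in> U \<Longrightarrow>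
      H x p \<inter> W \<subseteq> {z + (L * dist p q) *\<^sub>R v | z v. z \<in> H x q \<and> v \<in> cball 0 1}"
    using assms(3) unfolding lipschitz_like_const_x_def by blast
  define \<delta> where "\<delta> = min \<beta> (\<gamma> / (2 * L))"
  have "\<delta> > 0" using pos \<open>L > 0\<close> by (simp add: \<delta>_def)
  have "dist_set x (implicit_mf H p2) \<le> ereal (inverse c * L * dist p1 p2)"
    if p1: "p1 \<in> V \<inter> ball pb \<delta>" and p2: "p2 \<in> V \<inter> ball pb \<delta>"
      and x: "x \<in> implicit_mf H p1 \<inter> (U \<inter> ball xb \<alpha>)" for p1 p2 x
  proof -
    have "0 \<in> H x p1 \<inter> W"
      using x nbhds(3) interior_subset by (auto simp: implicit_mf_def)
    then have "0 \<in> {z + (L * dist p1 p2) *\<^sub>R v | z v. z \<in> H x p2 \<and> v \<in> cball 0 1}"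
      using lip[of p1 p2 x] p1 p2 x by blast
    then obtain z v where z: "0 = z + (L * dist p1 p2) *\<^sub>R v" "z \<in> H x p2" "norm v \<le> 1"
      by auto
    have "z = - ((L * dist p1 p2) *\<^sub>R v)"
      using z(1) by (simp add: eq_neg_iff_add_eq_0)
    then have "norm z = L * dist p1 p2 * norm v"
      using \<open>L > 0\<close> by (simp add: abs_mult)
    then have norm_z: "norm z \<le> L * dist p1 p2"
      using \<open>L > 0\<close> z(3) by (simp add: mult_left_le)
    have "dist p1 p2 < 2 * \<delta>"
      using p1 p2 dist_triangle_less_add[of p1 pb \<delta> p2 \<delta>] by (simp add: dist_commute)
    also have "\<dots> \<le> \<gamma> / L" by (simp add: \<delta>_def min_def field_simps)
    finally have "L * dist p1 p2 < \<gamma>" using \<open>L > 0\<close> by (simp add: field_simps)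
    with norm_z have "z \<in> ball 0 \<gamma>" by simp
    then have "dist_set x (implicit_mf H p2) \<le> ereal (inverse c * norm z)"
      using res z(2) x p2 by (simp add: \<delta>_def)
    also have "\<dots> \<le> ereal (inverse c * L * dist p1 p2)"
      using norm_z \<open>c > 0\<close> by (simp add: mult.assoc)
    finally show ?thesis .
  qed
  moreover have "pb \<in> interior (V \<inter> ball pb \<delta>)" "xb \<in> interior (U \<inter> ball xb \<alpha>)"
    using nbhds pos \<open>\<delta> > 0\<close> by simp_all
  ultimately show ?thesis
    unfolding lipschitz_like_const_def by blast
qed

text \<open>Let \<open>T\<close> satisfy the Lipschitz estimate on a neighborhood \<open>U\<close> of \<open>xb\<close> that contains \<open>ball xb r\<close>. For
  \<open>u \<in> T\<inverse> p\<close> in \<open>U\<close>, the estimate between \<open>u\<close> and \<open>x\<close> is the claim. If \<open>u\<close> is outside \<open>U\<close> and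
  \<open>dist xb x < r / 4\<close>, then \<open>dist x u \<ge> r / 2\<close>, and the crude bound of \<open>d p (T x)\<close> by a detour through the
  reference point \<open>pb \<in> T xb\<close> suffices: with \<open>dist p pb < L * r / 4\<close> it is at most
  \<open>L * r / 4 + L * (r / 4) = L * (r / 2)\<close>.\<close>

lemma lipschitz_like_imp_inverse_metrically_regular:
  fixes T :: "'x::metric_space \<Rightarrow> 'p::metric_space set"
  assumes "lipschitz_like_const L T xb pb" and "L > 0" and "pb \<in> T xb"
  shows "metrically_regular_const L (mf_inverse T) pb xb"
proof -
  obtain U V where nbhds: "xb \<in> interior U" "pb \<in> interior V"
    and lip: "\<And>u x p. u \<in> U \<Longrightarrow> x \<in> U \<Longrightarrow> p \<in> T u \<Longrightarrow> p \<in> V \<Longrightarrow>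
      dist_set p (T x) \<le> ereal (L * dist u x)"
    using assms(1) unfolding lipschitz_like_const_def by blast
  obtain r where "r > 0" and r: "ball xb r \<subseteq> U"
    using nbhds(1) unfolding mem_interior by blast
  have "dist_set p (mf_inverse (mf_inverse T) x) \<le> ereal L * dist_set x (mf_inverse T p)"
    if p: "p \<in> V \<inter> ball pb (L * r / 4)" and x: "x \<in> ball xb (r / 4)" for p x
    unfolding dist_set_def[of x]
  proof (rule le_mult_INF_ereal[OF \<open>L > 0\<close>])
    fix u assume "u \<in> mf_inverse T p"
    then have u: "p \<in> T u" by (simp add: mf_inverse_def)
    have "x \<in> U" using x r \<open>r > 0\<close> by auto
    have "dist_set p (T x) \<le> ereal (L * dist x u)"
    proof (cases "u \<in> U")
      case True
      then show ?thesis using lip[of u x p] u p \<open>x \<in> U\<close> by (simp add: dist_commute)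
    next
      case False
      then have "r \<le> dist xb u" using r by force
      then have "r / 2 \<le> dist x u"
        using dist_triangle[of xb u x] x \<open>r > 0\<close> by simp
      have "xb \<in> U" "pb \<in> V"
        using nbhds interior_subset by blast+
      then have near: "dist_set pb (T x) \<le> ereal (L * dist xb x)"
        using lip assms(3) \<open>x \<in> U\<close> by blast
      have "L * dist xb x \<le> L * (r / 4)"
        using x \<open>L > 0\<close> by (intro mult_left_mono) simp_all
      have "dist_set p (T x) \<le> ereal (dist p pb) + dist_set pb (T x)"
        by (rule dist_set_triangle)
      also have "\<dots> \<le> ereal (dist p pb) + ereal (L * dist xb x)"
        using near by (rule add_left_mono)
      also have "\<dots> \<le> ereal (L * r / 4 + L * (r / 4))"
        using p \<open>L * dist xb x \<le> L * (r / 4)\<close> by (simp add: dist_commute)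
      also have "\<dots> = ereal (L * (r / 2))" by simp
      also have "\<dots> \<le> ereal (L * dist x u)"
        using \<open>r / 2 \<le> dist x u\<close> \<open>L > 0\<close> by (simp del: times_divide_eq_right)
      finally show ?thesis .
    qed
    then show "dist_set p (mf_inverse (mf_inverse T) x) \<le> ereal (L * dist x u)"
      by (simp add: mf_inverse_def)
  qed
  moreover have "pb \<in> interior (V \<inter> ball pb (L * r / 4))" "xb \<in> interior (ball xb (r / 4))"
    using nbhds \<open>r > 0\<close> \<open>L > 0\<close> by simp_all
  ultimately show ?thesis
    unfolding metrically_regular_const_def by blast
qed

lemma INF_admissible_const_le_scaled:
  fixes k :: real
  assumes "k > 0" and "\<And>L. L > 0 \<Longrightarrow> A L \<Longrightarrow> B (k * L)"
  shows "(INF L\<in>{L. 0 < L \<and> B L}. ereal L) \<le> ereal k * (INF L\<in>{L. 0 < L \<and> A L}. ereal L)"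
  by (rule le_mult_INF_ereal) (use assms in \<open>auto intro!: INF_lower\<close>)

theorem theorem3p1:
  fixes H :: "'x::metric_space \<Rightarrow> 'p::metric_space \<Rightarrow> 'y::real_normed_vector set"
    and xb :: 'x and pb :: 'p and c :: real
  assumes "0 \<in> H xb pb" and "c > 0"
  shows
    "(open_at_rate_x c H xb pb 0 \<longrightarrow>
        (\<exists>\<alpha>>0. \<exists>\<beta>>0. \<exists>\<gamma>>0. \<forall>x\<in>ball xb \<alpha>. \<forall>p\<in>ball pb \<beta>.
          dist_set x (implicit_mf H p) \<le> ereal (inverse c) * dist_set 0 (H x p \<inter> ball 0 \<gamma>)) \<and>
        (lipschitz_like_p H xb pb 0 \<longrightarrow>
          lipschitz_like (implicit_mf H) pb xb \<and>
          lip_modulus (implicit_mf H) pb xb \<le> ereal (inverse c) * lip_hat_p H xb pb 0)) \<and>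
     (open_at_rate_p c H xb pb 0 \<longrightarrow>
        (\<exists>\<alpha>>0. \<exists>\<beta>>0. \<exists>\<gamma>>0. \<forall>x\<in>ball xb \<alpha>. \<forall>p\<in>ball pb \<beta>.
          dist_set p (mf_inverse (implicit_mf H) x)
            \<le> ereal (inverse c) * dist_set 0 (H x p \<inter> ball 0 \<gamma>)) \<and>
        (lipschitz_like_x H xb pb 0 \<longrightarrow>
          metrically_regular (implicit_mf H) pb xb \<and>
          reg_modulus (implicit_mf H) pb xb \<le> ereal (inverse c) * lip_hat_x H xb pb 0))"
proof (intro conjI impI)
  have "inverse c > 0" using \<open>c > 0\<close> by simp
  {
    assume opn: "open_at_rate_x c H xb pb 0"
    show "\<exists>\<alpha>>0. \<exists>\<beta>>0. \<exists>\<gamma>>0. \<forall>x\<in>ball xb \<alpha>. \<forall>p\<in>ball pb \<beta>.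
        dist_set x (implicit_mf H p) \<le> ereal (inverse c) * dist_set 0 (H x p \<inter> ball 0 \<gamma>)"
      by (rule implicit_mf_error_bound[OF opn \<open>c > 0\<close>])
    have lip: "lipschitz_like_const (inverse c * L) (implicit_mf H) pb xb"
      if "L > 0" "lipschitz_like_const_x L (\<lambda>p x. H x p) pb xb 0" for L
      using implicit_mf_lipschitz_like opn \<open>c > 0\<close> that by blast
    show "lip_modulus (implicit_mf H) pb xb \<le> ereal (inverse c) * lip_hat_p H xb pb 0"
      unfolding lip_modulus_def lip_hat_p_def lip_hat_x_def
      using \<open>inverse c > 0\<close> lip by (rule INF_admissible_const_le_scaled)
    assume "lipschitz_like_p H xb pb 0"
    then show "lipschitz_like (implicit_mf H) pb xb"
      unfolding lipschitz_like_p_def lipschitz_like_x_def lipschitz_like_def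
      using lip \<open>inverse c > 0\<close> mult_pos_pos by blast
  next
    assume "open_at_rate_p c H xb pb 0"
    then have opn: "open_at_rate_x c (\<lambda>p x. H x p) pb xb 0"
      by (simp add: open_at_rate_p_def)
    have swap: "implicit_mf (\<lambda>p x. H x p) = mf_inverse (implicit_mf H)"
      "mf_inverse (implicit_mf (\<lambda>p x. H x p)) = implicit_mf H"
      by (simp_all add: fun_eq_iff implicit_mf_def mf_inverse_def)
    show "\<exists>\<alpha>>0. \<exists>\<beta>>0. \<exists>\<gamma>>0. \<forall>x\<in>ball xb \<alpha>. \<forall>p\<in>ball pb \<beta>.
        dist_set p (mf_inverse (implicit_mf H) x)
          \<le> ereal (inverse c) * dist_set 0 (H x p \<inter> ball 0 \<gamma>)"
      using implicit_mf_error_bound[OF opn \<open>c > 0\<close>] unfolding swap by blast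
    have reg: "metrically_regular_const (inverse c * L) (implicit_mf H) pb xb"
      if "L > 0" "lipschitz_like_const_x L H xb pb 0" for L
    proof -
      have "lipschitz_like_const (inverse c * L) (implicit_mf (\<lambda>p x. H x p)) xb pb"
        using implicit_mf_lipschitz_like[OF opn \<open>c > 0\<close>] that by simp
      moreover have "pb \<in> implicit_mf (\<lambda>p x. H x p) xb"
        using assms(1) by (simp add: implicit_mf_def)
      ultimately show ?thesis
        using lipschitz_like_imp_inverse_metrically_regular mult_pos_pos[OF \<open>inverse c > 0\<close> \<open>L > 0\<close>]
        unfolding swap(2)[symmetric] by blast
    qed
    show "reg_modulus (implicit_mf H) pb xb \<le> ereal (inverse c) * lip_hat_x H xb pb 0"
      unfolding reg_modulus_def lip_hat_x_def
      using \<open>inverse c > 0\<close> reg by (rule INF_admissible_const_le_scaled)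
    assume "lipschitz_like_x H xb pb 0"
    then show "metrically_regular (implicit_mf H) pb xb"
      unfolding lipschitz_like_x_def metrically_regular_def
      using reg \<open>inverse c > 0\<close> mult_pos_pos by blast
  }
qed

end
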